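(* Let $\mathcal{W}\subset\mathbb{R}^d$ be a closed convex set with $\mathrm{dia}(\mathcal{W})<\infty$, let $\mathsf{F}$ be a family of convex differentiable functions on $\mathcal{W}$ with uniformly bounded gradients, and set $M=\sup_{\mathsf{g}\in\mathsf{F}}\sup_{w\in\mathcal{W}}\|\nabla\mathsf{g}(w)\|$, assumed positive. Let $\mathsf{f}_1,\dots,\mathsf{f}_n$ be independent samples from a distribution $\mu$ on $\mathsf{F}$, let $\sigma_1,\dots,\sigma_n>0$, and let $\eta_t=\frac{\mathrm{dia}(\mathcal{W})}{M\sqrt t}$. Then the randomly stopped noisy online gradient descent algorithm $$W_{t+1}=\Pi_{\mathcal{W}}\big(W_t-\eta_t\nabla\mathsf{f}_t(W_t)+\eta_t\sigma_tZ_t\big),\qquad Z_t\sim\mathcal{N}(0,\mathbf{I}_d)\ \text{i.i.d.},$$ started from a random $W_1\in\mathcal{W}$, with $T$ uniform on $\{1,\dots,n\}$, satisfies $$SR(n)\le\frac{3M\,\mathrm{dia}(\mathcal{W})}{2\sqrt n}+\frac{d}{2n}\sum_{t=1}^n\eta_t\sigma_t^2,$$ where $SR(n)=\mathbb{E}[\mathsf{f}(W_T)]-\inf_{w\in\mathcal{W}}\mathsf{f}(w)$ and $\mathsf{f}(w)=\mathbb{E}_{\mathsf{g}\sim\mu}[\mathsf{g}(w)]$.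
   Context: $\Pi_{\mathcal{W}}$ is the Euclidean projection onto $\mathcal{W}$; $\mathrm{dia}(\mathcal{W})=\sup_{w_1,w_2\in\mathcal{W}}\|w_1-w_2\|$. The random variables $W_1$, $T$, $\{\mathsf{f}_t\}$, $\{Z_t\}$ are mutually independent, and $\mathsf{f}(w)$ is assumed to be well defined and finite. The expectation $\mathbb{E}[\mathsf{f}(W_T)]$ is over all the randomness ($T$, $W_1$, $\{\mathsf{f}_t\}$, $\{Z_t\}$). The quantity $SR(n)$ is called the stochastic regret. *)

theory Defs
  imports "HOL-Probability.Probability"
begin

definition std_gaussian :: "'a::euclidean_space measure" where
  "std_gaussian = density lborel (\<lambda>z. ennreal (\<Prod>b\<in>Basis. std_normal_density (z \<bullet> b)))"

definition risk :: "('a \<Rightarrow> real) measure \<Rightarrow> 'a \<Rightarrow> real" where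
  "risk \<mu> w = (\<integral>g. g w \<partial>\<mu>)"

definition stochastic_regret ::
    "'w measure \<Rightarrow> ('a \<Rightarrow> real) measure \<Rightarrow> 'a set \<Rightarrow> ('w \<Rightarrow> 'a) \<Rightarrow> real" where
  "stochastic_regret P \<mu> \<W> X = (\<integral>\<omega>. risk \<mu> (X \<omega>) \<partial>P) - (INF w\<in>\<W>. risk \<mu> w)"

text \<open>
  The library's \<open>indep_vars\<close> needs all variables to share one codomain type. Here the variables
  take values in different types, so independence is expressed with \<open>indep_sets\<close> on the
  sigma-algebras they generate; the following type indexes the variables.
\<close>

datatype source = Initial | Stopping | Sample nat | Noise nat

definition generated_events :: "'w measure \<Rightarrow> 'b measure \<Rightarrow> ('w \<Rightarrow> 'b) \<Rightarrow> 'w set set" where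
  "generated_events P N X = {X -` A \<inter> space P | A. A \<in> sets N}"

definition independent_sources ::
    "'w measure \<Rightarrow> ('a::euclidean_space \<Rightarrow> real) measure \<Rightarrow> nat \<Rightarrow> ('w \<Rightarrow> 'a) \<Rightarrow> ('w \<Rightarrow> nat)
      \<Rightarrow> (nat \<Rightarrow> 'w \<Rightarrow> 'a \<Rightarrow> real) \<Rightarrow> (nat \<Rightarrow> 'w \<Rightarrow> 'a) \<Rightarrow> bool" where
  "independent_sources P \<mu> n W\<^sub>1 T f Z \<longleftrightarrow>
     prob_space.indep_sets P
       (\<lambda>s. case s of
              Initial \<Rightarrow> generated_events P borel W\<^sub>1
            | Stopping \<Rightarrow> generated_events P (count_space UNIV) T
            | Sample t \<Rightarrow> generated_events P \<mu> (f t)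
            | Noise t \<Rightarrow> generated_events P borel (Z t))
       ({Initial, Stopping} \<union> Sample ` {1..n} \<union> Noise ` {1..n})"

end

theory Submission
  imports Defs
begin

text \<open>
  Fix \<open>u\<close> in the domain. Since the projection is nonexpansive, each step changes the squared distance
  to \<open>u\<close> by at most \<open>- 2 \<eta>\<^sub>t \<langle>\<nabla>f\<^sub>t(W\<^sub>t), W\<^sub>t - u\<rangle>\<close>, plus the second-order terms \<open>\<eta>\<^sub>t\<^sup>2 M\<^sup>2\<close> and
  \<open>\<eta>\<^sub>t\<^sup>2 \<sigma>\<^sub>t\<^sup>2 \<parallel>Z\<^sub>t\<parallel>\<^sup>2\<close>, plus a term linear in \<open>Z\<^sub>t\<close>. The linear term has mean zero because \<open>Z\<^sub>t\<close> is
  independent of \<open>(W\<^sub>t, f\<^sub>t)\<close>. Since \<open>f\<^sub>t\<close> is independent of \<open>W\<^sub>t\<close>, integrating the tangent inequality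
  over \<open>f\<^sub>t\<close> bounds the excess risk of \<open>W\<^sub>t\<close> by the mean of the inner product. Dividing by
  \<open>2 \<eta>\<^sub>t\<close>, summing by parts and using \<open>\<Sum>\<^sub>t 1/\<surd>t \<le> 2\<surd>n\<close> bounds the total excess risk, and the
  independence of \<open>T\<close> turns its average into the excess risk of \<open>W\<^sub>T\<close>.
\<close>

section \<open>Tangent inequality for convex functions\<close>

text \<open>Along the segment from \<open>w\<close> to \<open>u\<close>, convexity keeps every
  difference quotient at \<open>w\<close> at most \<open>g u - g w\<close>, while the quotients tend
  to \<open>d \<bullet> (u - w)\<close>. The segment stays in \<open>S\<close>, so a derivative
  within \<open>S\<close> suffices even when \<open>S\<close> has empty interior.\<close>

lemma convex_on_above_tangent_within:
  fixes g :: "'a::real_inner \<Rightarrow> real"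
  assumes cvx: "convex_on S g" and w: "w \<in> S" and u: "u \<in> S"
    and der: "(g has_derivative (\<lambda>h. d \<bullet> h)) (at w within S)"
  shows "g w - g u \<le> d \<bullet> (w - u)"
proof -
  define line where "line s = w + s *\<^sub>R (u - w)" for s :: real
  have line_eq: "line s = (1 - s) *\<^sub>R w + s *\<^sub>R u" for s
    by (simp add: line_def algebra_simps)
  have sub: "line ` {0..1} \<subseteq> S"
    using convex_on_imp_convex[OF cvx] w u by (auto simp: line_eq convex_alt)
  have "(line has_derivative (\<lambda>s. s *\<^sub>R (u - w))) (at 0 within {0..1})"
    unfolding line_def by (auto intro!: derivative_eq_intros)
  moreover have "(g has_derivative (\<lambda>h. d \<bullet> h)) (at (line 0) within line ` {0..1})"
    using has_derivative_subset[OF der sub] by (simp add: line_def)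
  ultimately have "((\<lambda>s. g (line s)) has_derivative (\<lambda>s. d \<bullet> (s *\<^sub>R (u - w)))) (at 0 within {0..1})"
    by (rule has_derivative_in_compose)
  then have "((\<lambda>s. g (line s)) has_field_derivative (d \<bullet> (u - w))) (at 0 within {0..1})"
    by (simp add: has_field_derivative_def mult_commute_abs)
  then have "((\<lambda>s. (g (line s) - g (line 0)) / (s - 0)) \<longlongrightarrow> d \<bullet> (u - w)) (at_right 0)"
    by (simp add: has_field_derivative_iff at_within_Icc_at_right)
  moreover have "\<forall>\<^sub>F s in at_right 0. (g (line s) - g (line 0)) / (s - 0) \<le> g u - g w"
  proof -
    have "(g (line s) - g (line 0)) / (s - 0) \<le> g u - g w" if "0 < s" "s < 1" for s
    proof -
      have "g (line s) \<le> (1 - s) * g w + s * g u"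
        unfolding line_eq using convex_onD[OF cvx _ _ w u, of s] that by simp
      then show ?thesis
        using that by (simp add: line_def field_simps)
    qed
    then show ?thesis
      by (auto simp: eventually_at_right_field intro!: exI[of _ 1])
  qed
  ultimately have "d \<bullet> (u - w) \<le> g u - g w"
    by (rule tendsto_upperbound) simp
  then show ?thesis by (simp add: inner_diff_right)
qed

section \<open>Moments of the standard Gaussian and independent cross terms\<close>

text \<open>The density is a product over the basis, so the measure of a cylinder over
  \<open>A\<close> factors into one-dimensional integrals; all of them are total masses equal to 1,
  except the one at \<open>b\<close>.\<close>

lemma distr_std_gaussian_component:
  assumes b: "(b::'a::euclidean_space) \<in> Basis"
  shows "distr std_gaussian borel (\<lambda>z. z \<bullet> b) = std_normal_distribution"
proof (rule measure_eqI)
  fix A assume "A \<in> sets (distr std_gaussian borel (\<lambda>z::'a. z \<bullet> b))"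
  then have A[measurable]: "A \<in> sets borel" by simp
  \<comment> \<open>The indicator of \<open>A\<close> is attached to the factor at \<open>b\<close>
    alone, so that the integrand remains a product over the coordinates.\<close>
  define dens where
    "dens c x = ennreal (std_normal_density x) * (if c = b then indicator A x else 1)" for c :: 'a and x
  have [measurable]: "dens c \<in> borel_measurable borel" for c
    unfolding dens_def by (cases "c = b") simp_all
  have mass: "(\<integral>\<^sup>+x. ennreal (std_normal_density x) \<partial>lborel) = 1"
    using prob_space.emeasure_space_1[OF prob_space_normal_density[of 1 0]]
    by (simp add: emeasure_density)
  have "emeasure (distr std_gaussian borel (\<lambda>z::'a. z \<bullet> b)) A
      = emeasure std_gaussian ((\<lambda>z::'a. z \<bullet> b) -` A)"
    by (subst emeasure_distr) (auto simp: std_gaussian_def)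
  also have "\<dots> = (\<integral>\<^sup>+z. ennreal (\<Prod>c\<in>Basis. std_normal_density (z \<bullet> c))
                    * indicator ((\<lambda>z::'a. z \<bullet> b) -` A) z \<partial>lborel)"
    unfolding std_gaussian_def
    by (rule emeasure_density) (use measurable_sets[of "\<lambda>z::'a. z \<bullet> b" borel borel A] in auto)
  also have "\<dots> = (\<integral>\<^sup>+z. (\<Prod>c\<in>Basis. dens c (z \<bullet> c)) \<partial>lborel)"
  proof (rule nn_integral_cong)
    fix z :: 'a
    have "(\<Prod>c\<in>Basis. dens c (z \<bullet> c)) = ennreal (\<Prod>c\<in>Basis. std_normal_density (z \<bullet> c))
         * (\<Prod>c\<in>Basis. if c = b then indicator A (z \<bullet> c) else 1)"
      by (simp add: dens_def prod.distrib prod_ennreal)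
    also have "(\<Prod>c\<in>Basis. if c = b then indicator A (z \<bullet> c) else (1::ennreal))
        = indicator ((\<lambda>z::'a. z \<bullet> b) -` A) z"
      using b by (subst prod.delta) (auto simp: indicator_def)
    finally show "ennreal (\<Prod>c\<in>Basis. std_normal_density (z \<bullet> c))
          * indicator ((\<lambda>z::'a. z \<bullet> b) -` A) z = (\<Prod>c\<in>Basis. dens c (z \<bullet> c))" ..
  qed
  also have "\<dots> = (\<Prod>c\<in>Basis. \<integral>\<^sup>+x. dens c x \<partial>lborel)"
    by (rule nn_integral_lborel_prod) simp_all
  also have "\<dots> = (\<Prod>c\<in>Basis. if c = b then emeasure std_normal_distribution A else 1)"
    by (rule prod.cong) (auto simp: dens_def mass emeasure_density)
  also have "\<dots> = emeasure std_normal_distribution A"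
    using b by (subst prod.delta) auto
  finally show "emeasure (distr std_gaussian borel (\<lambda>z::'a. z \<bullet> b)) A
      = emeasure std_normal_distribution A" .
qed simp

context
  fixes P :: "'w measure" and Z :: "'w \<Rightarrow> 'a::euclidean_space"
  assumes Z[measurable]: "Z \<in> borel_measurable P" and law: "distr P borel Z = std_gaussian"
begin

lemma distr_gaussian_component:
  assumes "b \<in> Basis"
  shows "distr P borel (\<lambda>\<omega>. Z \<omega> \<bullet> b) = std_normal_distribution"
proof -
  have "distr P borel (\<lambda>\<omega>. Z \<omega> \<bullet> b) = distr (distr P borel Z) borel (\<lambda>z. z \<bullet> b)"
    by (simp add: distr_distr comp_def)
  then show ?thesis
    using distr_std_gaussian_component[OF assms] by (simp add: law)
qed

lemma gaussian_component_moments: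
  assumes "b \<in> Basis"
  shows "integrable P (\<lambda>\<omega>. Z \<omega> \<bullet> b)" "(\<integral>\<omega>. Z \<omega> \<bullet> b \<partial>P) = 0"
    "integrable P (\<lambda>\<omega>. (Z \<omega> \<bullet> b)\<^sup>2)" "(\<integral>\<omega>. (Z \<omega> \<bullet> b)\<^sup>2 \<partial>P) = 1"
proof -
  note d = distr_gaussian_component[OF assms]
  have int: "integrable P (\<lambda>\<omega>. (Z \<omega> \<bullet> b) ^ k)" for k
    using integrable_std_normal_distribution_moment[of k] unfolding d[symmetric]
    by (subst (asm) integrable_distr_eq) auto
  have eq: "(\<integral>\<omega>. (Z \<omega> \<bullet> b) ^ k \<partial>P) = (\<integral>x. x ^ k \<partial>std_normal_distribution)" for k
    unfolding d[symmetric] by (subst integral_distr) auto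
  show "integrable P (\<lambda>\<omega>. Z \<omega> \<bullet> b)" "integrable P (\<lambda>\<omega>. (Z \<omega> \<bullet> b)\<^sup>2)"
    using int[of 1] int[of 2] by simp_all
  show "(\<integral>\<omega>. Z \<omega> \<bullet> b \<partial>P) = 0"
    using eq[of 1] integral_std_normal_distribution_moment_odd[of 1] by simp
  show "(\<integral>\<omega>. (Z \<omega> \<bullet> b)\<^sup>2 \<partial>P) = 1"
    using eq[of 2] std_normal_distribution_even_moments[of 1] by simp
qed

text \<open>Each coordinate contributes a second moment of 1; this is the source of the dimension
  factor in the final bound.\<close>

lemma gaussian_norm_square:
  shows "integrable P (\<lambda>\<omega>. (norm (Z \<omega>))\<^sup>2)" "(\<integral>\<omega>. (norm (Z \<omega>))\<^sup>2 \<partial>P) = DIM('a)"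
proof -
  have eq: "(norm z)\<^sup>2 = (\<Sum>b\<in>Basis. (z \<bullet> b)\<^sup>2)" for z :: 'a
    unfolding power2_norm_eq_inner by (subst euclidean_inner) (simp add: power2_eq_square)
  show "integrable P (\<lambda>\<omega>. (norm (Z \<omega>))\<^sup>2)" "(\<integral>\<omega>. (norm (Z \<omega>))\<^sup>2 \<partial>P) = DIM('a)"
    unfolding eq using gaussian_component_moments by (simp_all add: Bochner_Integration.integral_sum)
qed

end

text \<open>In a basis the inner product is a sum of products of independent real variables. Each
  expectation factors and the zero mean of the \<open>X\<close> coordinate annihilates it. The
  intended \<open>X\<close> is the Gaussian noise of a round.\<close>

lemma inner_indep_zero_mean:
  fixes X Y :: "'w \<Rightarrow> 'a::euclidean_space"
  assumes "prob_space P"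
    and indep: "\<And>b. b \<in> Basis \<Longrightarrow> prob_space.indep_var P borel (\<lambda>\<omega>. X \<omega> \<bullet> b) borel (\<lambda>\<omega>. Y \<omega> \<bullet> b)"
    and X: "\<And>b. b \<in> Basis \<Longrightarrow> integrable P (\<lambda>\<omega>. X \<omega> \<bullet> b)"
      "\<And>b. b \<in> Basis \<Longrightarrow> (\<integral>\<omega>. X \<omega> \<bullet> b \<partial>P) = 0"
    and Y: "integrable P Y"
  shows "integrable P (\<lambda>\<omega>. X \<omega> \<bullet> Y \<omega>)" "(\<integral>\<omega>. X \<omega> \<bullet> Y \<omega> \<partial>P) = 0"
proof -
  interpret prob_space P by fact
  have prod: "integrable P (\<lambda>\<omega>. (X \<omega> \<bullet> b) * (Y \<omega> \<bullet> b))"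
    "(\<integral>\<omega>. (X \<omega> \<bullet> b) * (Y \<omega> \<bullet> b) \<partial>P) = 0" if "b \<in> Basis" for b
    using indep_var_integrable[OF indep[OF that]] indep_var_lebesgue_integral[OF indep[OF that]]
      X[OF that] Y by auto
  have eq: "(\<lambda>\<omega>. X \<omega> \<bullet> Y \<omega>) = (\<lambda>\<omega>. \<Sum>b\<in>Basis. (X \<omega> \<bullet> b) * (Y \<omega> \<bullet> b))"
    by (rule ext, rule euclidean_inner)
  show "integrable P (\<lambda>\<omega>. X \<omega> \<bullet> Y \<omega>)" "(\<integral>\<omega>. X \<omega> \<bullet> Y \<omega> \<partial>P) = 0"
    unfolding eq using prod by (simp_all add: Bochner_Integration.integral_sum)
qed

section \<open>Independence of sigma-algebras generated by groups of sources\<close>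

text \<open>Independence of intersection-stable generators passes to the sigma-algebras generated by
  disjoint groups of them. It serves to separate a fresh source from everything that happened
  before.\<close>

lemma (in prob_space) indep_set_sigma_sets_Union:
  assumes "indep_sets E I" and stable: "\<And>i. i \<in> I \<Longrightarrow> Int_stable (E i)"
    and KL: "K \<subseteq> I" "L \<subseteq> I" "K \<inter> L = {}"
  shows "indep_set (sigma_sets (space M) (\<Union>i\<in>K. E i)) (sigma_sets (space M) (\<Union>i\<in>L. E i))"
proof -
  have "indep_sets (\<lambda>j. sigma_sets (space M) (\<Union>i\<in>case_bool K L j. E i)) UNIV"
  proof (rule indep_sets_collect_sigma)
    show "indep_sets E (\<Union>j. case_bool K L j)"
      using assms by (auto simp: UNIV_bool intro: indep_sets_mono_index)
    show "Int_stable (E i)" if "i \<in> case_bool K L j" for i j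
      using that KL stable by (cases j) auto
    show "disjoint_family (case_bool K L)"
      using KL by (auto simp: disjoint_family_on_def split: bool.split)
  qed
  moreover have "(\<lambda>j. sigma_sets (space M) (\<Union>i\<in>case_bool K L j. E i))
    = case_bool (sigma_sets (space M) (\<Union>i\<in>K. E i)) (sigma_sets (space M) (\<Union>i\<in>L. E i))"
    by (rule ext) (simp split: bool.split)
  ultimately show ?thesis by (simp add: indep_set_def)
qed

context prob_space
begin

context
  fixes G H :: "'a measure"
  assumes sp: "space G = space M" "space H = space M" and indep: "indep_set (sets G) (sets H)"
begin

text \<open>Independence of two families of sets includes that their members are events of
  \<open>M\<close>, so both \<open>G\<close> and \<open>H\<close> are sub-sigma-algebras.\<close>

lemma measurable_sub_sigma_algebra:
  shows "X \<in> measurable G N \<Longrightarrow> X \<in> measurable M N" "X \<in> measurable H N \<Longrightarrow> X \<in> measurable M N"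
  using indep_setD_ev1[OF indep] indep_setD_ev2[OF indep] sp
  by (auto simp: measurable_def)

lemma indep_var_of_indep_sigma_algebras:
  assumes X: "X \<in> measurable G N" and Y: "Y \<in> measurable H N'"
  shows "indep_var N X N' Y"
proof -
  have "sigma_sets (space M) {X -` A \<inter> space M |A. A \<in> sets N} \<subseteq> sets G"
    using measurable_sets[OF X] by (auto simp: sp(1) intro!: sets.sigma_sets_subset[of _ G, unfolded sp(1)])
  moreover have "sigma_sets (space M) {Y -` A \<inter> space M |A. A \<in> sets N'} \<subseteq> sets H"
    using measurable_sets[OF Y] by (auto simp: sp(2) intro!: sets.sigma_sets_subset[of _ H, unfolded sp(2)])
  ultimately have "indep_set (sigma_sets (space M) {X -` A \<inter> space M |A. A \<in> sets N})
      (sigma_sets (space M) {Y -` A \<inter> space M |A. A \<in> sets N'})"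
    using indep unfolding indep_sets2_eq by (blast intro: subset_trans)
  then show ?thesis
    using X Y by (auto simp: indep_var_eq measurable_sub_sigma_algebra)
qed

text \<open>Both measures agree on rectangles by independence, and for sigma-finite factors this
  determines the product. \<open>X\<close> and \<open>Y\<close> may have values in different types,
  as a loss function and an iterate do.\<close>

lemma distr_Pair_of_indep_sigma_algebras:
  assumes X: "X \<in> measurable G N" and Y: "Y \<in> measurable H N'"
  shows "distr M (N \<Otimes>\<^sub>M N') (\<lambda>\<omega>. (X \<omega>, Y \<omega>)) = distr M N X \<Otimes>\<^sub>M distr M N' Y"
proof -
  note [measurable] = measurable_sub_sigma_algebra(1)[OF X] measurable_sub_sigma_algebra(2)[OF Y]
  interpret X: prob_space "distr M N X" by (rule prob_space_distr) simp
  interpret Y: prob_space "distr M N' Y" by (rule prob_space_distr) simp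
  show ?thesis
  proof (rule pair_measure_eqI[symmetric])
    fix A B assume "A \<in> sets (distr M N X)" "B \<in> sets (distr M N' Y)"
    then have AB[measurable]: "A \<in> sets N" "B \<in> sets N'" by simp_all
    have "X -` A \<inter> space M \<in> sets G" "Y -` B \<inter> space M \<in> sets H"
      using measurable_sets[OF X AB(1)] measurable_sets[OF Y AB(2)] by (simp_all add: sp)
    then have "prob ((X -` A \<inter> space M) \<inter> (Y -` B \<inter> space M))
        = prob (X -` A \<inter> space M) * prob (Y -` B \<inter> space M)"
      by (rule indep_setD[OF indep])
    moreover have "(\<lambda>\<omega>. (X \<omega>, Y \<omega>)) -` (A \<times> B) \<inter> space M
        = (X -` A \<inter> space M) \<inter> (Y -` B \<inter> space M)" by auto
    ultimately show "emeasure (distr M N X) A * emeasure (distr M N' Y) B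
        = emeasure (distr M (N \<Otimes>\<^sub>M N') (\<lambda>\<omega>. (X \<omega>, Y \<omega>))) (A \<times> B)"
      by (simp add: emeasure_distr emeasure_eq_measure ennreal_mult)
  next
    show "sets (distr M N X \<Otimes>\<^sub>M distr M N' Y) = sets (distr M (N \<Otimes>\<^sub>M N') (\<lambda>\<omega>. (X \<omega>, Y \<omega>)))"
      unfolding sets_distr by (rule sets_pair_measure_cong) simp_all
  qed (fact X.sigma_finite_measure_axioms Y.sigma_finite_measure_axioms)+
qed

end

end

lemma Int_stable_generated_events: "Int_stable (generated_events P N X)"
proof (rule Int_stableI)
  fix a b assume "a \<in> generated_events P N X" "b \<in> generated_events P N X"
  then obtain A B where "A \<in> sets N" "B \<in> sets N" "a = X -` A \<inter> space P" "b = X -` B \<inter> space P"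
    by (auto simp: generated_events_def)
  then show "a \<inter> b \<in> generated_events P N X"
    by (auto simp: generated_events_def intro!: exI[of _ "A \<inter> B"])
qed

lemma measurable_sigma_generated_events:
  assumes "X \<in> space P \<rightarrow> space N" "generated_events P N X \<subseteq> \<A>" "\<A> \<subseteq> Pow (space P)"
  shows "X \<in> measurable (sigma (space P) \<A>) N"
proof (rule measurableI)
  fix A assume "A \<in> sets N"
  then have "X -` A \<inter> space P \<in> \<A>"
    using assms(2) by (auto simp: generated_events_def)
  then show "X -` A \<inter> space (sigma (space P) \<A>) \<in> sets (sigma (space P) \<A>)"
    using assms(3) by auto
qed (use assms in auto)

section \<open>Deterministic step inequality, sums, and integration over a fresh loss\<close>

text \<open>Since \<open>u\<close> is its own projection, nonexpansiveness allows the projection to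
  be dropped before the square is expanded. Everything linear in \<open>z\<close> is collected into
  a single inner product, ready to vanish in expectation.\<close>

lemma projected_noisy_step:
  fixes w u d z :: "'a::euclidean_space"
  assumes S: "closed S" "convex S" and u: "u \<in> S" and M: "norm d \<le> M"
  shows "2 * \<eta> * (d \<bullet> (w - u))
    \<le> (norm (w - u))\<^sup>2 - (norm (closest_point S (w - \<eta> *\<^sub>R d + (\<eta> * \<sigma>) *\<^sub>R z) - u))\<^sup>2
      + \<eta>\<^sup>2 * M\<^sup>2 + \<eta>\<^sup>2 * \<sigma>\<^sup>2 * (norm z)\<^sup>2 + 2 * \<eta> * \<sigma> * (z \<bullet> (w - u - \<eta> *\<^sub>R d))"
proof -
  let ?y = "w - \<eta> *\<^sub>R d + (\<eta> * \<sigma>) *\<^sub>R z"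
  have "dist (closest_point S ?y) (closest_point S u) \<le> dist ?y u"
    using S u by (intro closest_point_lipschitz) auto
  then have "(norm (closest_point S ?y - u))\<^sup>2 \<le> (norm (?y - u))\<^sup>2"
    using closest_point_self[OF u] by (intro power_mono) (auto simp: dist_norm)
  also have "\<dots> = (norm (w - u))\<^sup>2 - 2 * \<eta> * (d \<bullet> (w - u)) + \<eta>\<^sup>2 * (norm d)\<^sup>2
      + \<eta>\<^sup>2 * \<sigma>\<^sup>2 * (norm z)\<^sup>2 + 2 * \<eta> * \<sigma> * (z \<bullet> (w - u - \<eta> *\<^sub>R d))"
    unfolding power2_norm_eq_inner
    by (simp add: inner_simps inner_commute algebra_simps power2_eq_square)
  also have "\<dots> \<le> (norm (w - u))\<^sup>2 - 2 * \<eta> * (d \<bullet> (w - u)) + \<eta>\<^sup>2 * M\<^sup>2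
      + \<eta>\<^sup>2 * \<sigma>\<^sup>2 * (norm z)\<^sup>2 + 2 * \<eta> * \<sigma> * (z \<bullet> (w - u - \<eta> *\<^sub>R d))"
    using M by (simp add: mult_left_mono power_mono)
  finally show ?thesis by simp
qed

text \<open>Summation by parts, done by induction: the bound keeps the term
  \<open>B - D (Suc m)\<close>, which is nonnegative as long as a further step remains, so its
  weight may be raised from \<open>a m\<close> to \<open>a (Suc m)\<close> and the sum
  telescopes.\<close>

lemma sum_weighted_differences_le:
  fixes a D :: "nat \<Rightarrow> real"
  assumes "1 \<le> n" and "0 \<le> a 1" and mono: "\<And>t. 1 \<le> t \<Longrightarrow> t < n \<Longrightarrow> a t \<le> a (Suc t)"
    and D: "\<And>t. 1 \<le> t \<Longrightarrow> t \<le> n \<Longrightarrow> D t \<le> B"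
  shows "(\<Sum>t=1..n. a t * (D t - D (Suc t))) \<le> a n * (B - D (Suc n))"
  using \<open>1 \<le> n\<close> mono D
proof (induction n rule: dec_induct)
  case base
  then show ?case using \<open>0 \<le> a 1\<close> by (simp add: mult_left_mono)
next
  case (step m)
  have "(\<Sum>t=1..Suc m. a t * (D t - D (Suc t)))
      \<le> a m * (B - D (Suc m)) + a (Suc m) * (D (Suc m) - D (Suc (Suc m)))"
    using step by simp
  also have "\<dots> \<le> a (Suc m) * (B - D (Suc m)) + a (Suc m) * (D (Suc m) - D (Suc (Suc m)))"
    using step by (intro add_right_mono mult_right_mono) auto
  finally show ?case by (simp add: algebra_simps)
qed

text \<open>The arithmetic-geometric mean inequality for consecutive square roots bounds each
  summand by twice their difference, which telescopes.\<close>

lemma sum_inverse_sqrt_le: "(\<Sum>t=1..n. 1 / sqrt (real t)) \<le> 2 * sqrt (real n)"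
proof (induction n)
  case (Suc n)
  have "2 * sqrt (real n) * sqrt (real (Suc n)) \<le> real n + real (Suc n)"
    using sum_squares_bound[of "sqrt (real n)" "sqrt (real (Suc n))"] by simp
  then have "1 / sqrt (real (Suc n)) \<le> 2 * sqrt (real (Suc n)) - 2 * sqrt (real n)"
    by (simp add: field_simps)
  then show ?case using Suc by simp
qed simp

text \<open>Fubini: under the product law the first variable is integrated with the second one
  frozen, where \<open>bound\<close> applies. With \<open>X\<close> a fresh loss and
  \<open>Y\<close> the iterate, this replaces conditioning on the iterate.\<close>

lemma (in prob_space) expectation_le_of_conditional_bound:
  fixes h :: "'x \<times> 'y \<Rightarrow> real"
  assumes [measurable]: "X \<in> measurable M N" "Y \<in> measurable M N'"
      "h \<in> borel_measurable (N \<Otimes>\<^sub>M N')" "r \<in> borel_measurable N'"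
    and joint: "distr M (N \<Otimes>\<^sub>M N') (\<lambda>\<omega>. (X \<omega>, Y \<omega>)) = distr M N X \<Otimes>\<^sub>M distr M N' Y"
    and h: "integrable M (\<lambda>\<omega>. h (X \<omega>, Y \<omega>))" and r: "integrable M (\<lambda>\<omega>. r (Y \<omega>))"
    and bound: "\<And>y. y \<in> space N' \<Longrightarrow> r y \<le> (\<integral>x. h (x, y) \<partial>distr M N X)"
  shows "(\<integral>\<omega>. r (Y \<omega>) \<partial>M) \<le> (\<integral>\<omega>. h (X \<omega>, Y \<omega>) \<partial>M)"
proof -
  interpret X: prob_space "distr M N X" by (rule prob_space_distr) simp
  interpret Y: prob_space "distr M N' Y" by (rule prob_space_distr) simp
  interpret XY: pair_sigma_finite "distr M N X" "distr M N' Y" ..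
  have h': "integrable (distr M N X \<Otimes>\<^sub>M distr M N' Y) h"
    unfolding joint[symmetric] using h by (subst integrable_distr_eq) simp_all
  have "(\<integral>\<omega>. r (Y \<omega>) \<partial>M) = (\<integral>y. r y \<partial>distr M N' Y)"
    by (subst integral_distr) simp_all
  also have "\<dots> \<le> (\<integral>y. (\<integral>x. h (x, y) \<partial>distr M N X) \<partial>distr M N' Y)"
    using XY.integrable_snd[of "curry h"] h' r bound
    by (intro integral_mono) (simp_all add: integrable_distr_eq)
  also have "\<dots> = (\<integral>z. h z \<partial>(distr M N X \<Otimes>\<^sub>M distr M N' Y))"
    using XY.integral_snd[of "curry h"] h' by simp
  also have "\<dots> = (\<integral>\<omega>. h (X \<omega>, Y \<omega>) \<partial>M)"
    unfolding joint[symmetric] by (subst integral_distr) simp_all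
  finally show ?thesis .
qed

section \<open>The regret bound\<close>

text \<open>When \<open>\<W>\<close> has empty interior, the derivative within \<open>\<W>\<close>
  does not determine a gradient, so \<open>grad\<close> is a fixed choice, jointly measurable in
  loss and point. \<open>bounded_gradients\<close> makes the nested suprema in \<open>M\<close>
  genuine.\<close>

theorem proposition2:
  fixes \<W> :: "(real ^ 'd) set"
    and F :: "(real ^ 'd \<Rightarrow> real) set"
    and grad :: "(real ^ 'd \<Rightarrow> real) \<Rightarrow> real ^ 'd \<Rightarrow> real ^ 'd"
    and M :: real
    and \<mu> :: "(real ^ 'd \<Rightarrow> real) measure"
    and P :: "'w measure"
    and n :: nat
    and f :: "nat \<Rightarrow> 'w \<Rightarrow> real ^ 'd \<Rightarrow> real"
    and \<sigma> \<eta> :: "nat \<Rightarrow> real"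
    and Z W :: "nat \<Rightarrow> 'w \<Rightarrow> real ^ 'd"
    and T :: "'w \<Rightarrow> nat"
  assumes domain: "closed \<W>" "convex \<W>" "bounded \<W>"
    and convex_losses: "\<And>g. g \<in> F \<Longrightarrow> convex_on \<W> g"
    and gradients: "\<And>g w. g \<in> F \<Longrightarrow> w \<in> \<W> \<Longrightarrow>
          (g has_derivative (\<lambda>h. grad g w \<bullet> h)) (at w within \<W>)"
    and bounded_gradients: "\<exists>B. \<forall>g\<in>F. \<forall>w\<in>\<W>. norm (grad g w) \<le> B"
    and M: "M = (SUP g\<in>F. SUP w\<in>\<W>. norm (grad g w))" "M > 0"
    and law: "prob_space \<mu>" "space \<mu> = F"
    and gradient_measurable:
      "(\<lambda>(g, w). grad g w) \<in> borel_measurable (\<mu> \<Otimes>\<^sub>M restrict_space borel \<W>)"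
    and risk_finite: "\<And>w. w \<in> \<W> \<Longrightarrow> integrable \<mu> (\<lambda>g. g w)"
    and prob: "prob_space P"
    and n: "n \<ge> 1"
    and samples: "\<And>t. t \<in> {1..n} \<Longrightarrow> f t \<in> measurable P \<mu>"
      "\<And>t. t \<in> {1..n} \<Longrightarrow> distr P \<mu> (f t) = \<mu>"
    and noise: "\<And>t. t \<in> {1..n} \<Longrightarrow> Z t \<in> borel_measurable P"
      "\<And>t. t \<in> {1..n} \<Longrightarrow> distr P borel (Z t) = std_gaussian"
    and stopping: "T \<in> measurable P (count_space {1..n})"
      "distr P (count_space {1..n}) T = uniform_count_measure {1..n}"
    and initial: "W 1 \<in> measurable P (restrict_space borel \<W>)"
    and independent: "independent_sources P \<mu> n (W 1) T f Z"
    and \<sigma>: "\<And>t. t \<in> {1..n} \<Longrightarrow> \<sigma> t > 0"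
    and \<eta>: "\<And>t. t \<in> {1..n} \<Longrightarrow> \<eta> t = diameter \<W> / (M * sqrt (real t))"
    and algorithm: "\<And>t \<omega>. t \<in> {1..n} \<Longrightarrow> \<omega> \<in> space P \<Longrightarrow>
          W (t + 1) \<omega> = closest_point \<W>
            (W t \<omega> - \<eta> t *\<^sub>R grad (f t \<omega>) (W t \<omega>) + (\<eta> t * \<sigma> t) *\<^sub>R Z t \<omega>)"
  shows "stochastic_regret P \<mu> \<W> (\<lambda>\<omega>. W (T \<omega>) \<omega>)
    \<le> 3 * M * diameter \<W> / (2 * sqrt (real n))
      + real CARD('d) / (2 * real n) * (\<Sum>t=1..n. \<eta> t * (\<sigma> t)\<^sup>2)"
proof -

  \<comment> \<open>Sources of randomness and their sigma-algebras\<close>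
  interpret P: prob_space P by (rule prob)
  interpret \<mu>: prob_space \<mu> by (rule law(1))
  \<comment> \<open>Joint measurability of \<open>grad\<close> is given over this restricted space,
    so iterates are treated as variables with values in it before \<open>grad\<close> is applied to
    them.\<close>
  define RW where "RW = restrict_space (borel :: (real ^ 'd) measure) \<W>"
  have space_RW[simp]: "space RW = \<W>" by (simp add: RW_def space_restrict_space)
  define \<delta> where "\<delta> = diameter \<W>"
  define E where "E s = (case s of
              Initial \<Rightarrow> generated_events P borel (W 1)
            | Stopping \<Rightarrow> generated_events P (count_space UNIV) T
            | Sample t \<Rightarrow> generated_events P \<mu> (f t)
            | Noise t \<Rightarrow> generated_events P borel (Z t))" for s
  define I where "I = {Initial, Stopping} \<union> Sample ` {1..n} \<union> Noise ` {1..n}"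
  define G where "G K = sigma (space P) (\<Union>i\<in>K. E i)" for K
  \<comment> \<open>These sources determine \<open>W t\<close>: rounds strictly before
    \<open>t\<close>. Hence \<open>Sample t\<close>, \<open>Noise t\<close> and
    \<open>Stopping\<close> all lie outside.\<close>
  define past where "past t = {Initial} \<union> Sample ` {1..<t} \<union> Noise ` {1..<t}" for t
  have E_Pow: "(\<Union>i\<in>K. E i) \<subseteq> Pow (space P)" for K
    by (auto simp: E_def generated_events_def split: source.splits)
  have space_G[simp]: "space (G K) = space P" for K
    by (simp add: G_def space_measure_of_conv)
  have indep_E: "P.indep_sets E I"
    using independent unfolding independent_sources_def E_def I_def .
  have indep_G: "P.indep_set (sets (G K)) (sets (G L))"
    if "K \<subseteq> I" "L \<subseteq> I" "K \<inter> L = {}" for K L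
  proof -
    have "Int_stable (E i)" for i
      by (cases i) (simp_all add: E_def Int_stable_generated_events)
    then show ?thesis
      using P.indep_set_sigma_sets_Union[OF indep_E _ that] E_Pow by (simp add: G_def)
  qed
  have G_measurable: "X \<in> measurable (G K) N"
    if "E i = generated_events P N X" "i \<in> K" "X \<in> space P \<rightarrow> space N" for X N i K
    unfolding G_def using that E_Pow by (intro measurable_sigma_generated_events) auto
  have past_sub: "insert (Sample t) (past t) \<subseteq> I" if "t \<in> {1..n}" for t
    using that by (auto simp: past_def I_def)
  have past_sub': "past t \<subseteq> I" if "t \<in> {1..Suc n}" for t
    using that by (auto simp: past_def I_def)

  \<comment> \<open>Membership, gradient bounds and regularity of the risk\<close>
  have f_in: "f t \<omega> \<in> F" if "t \<in> {1..n}" "\<omega> \<in> space P" for t \<omega>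
    using measurable_space[OF samples(1)[OF that(1)] that(2)] law(2) by simp
  have "W 1 \<in> space P \<rightarrow> \<W>"
    using measurable_space[OF initial] by (auto simp: space_restrict_space)
  then have ne: "\<W> \<noteq> {}" using P.not_empty by auto
  have F_ne: "F \<noteq> {}" using \<mu>.not_empty law(2) by simp
  \<comment> \<open>The range reaches \<open>Suc n\<close> because the inequality for round
    \<open>n\<close> involves the distance of \<open>W (Suc n)\<close> to \<open>u\<close>.\<close>
  have W_in: "W t \<omega> \<in> \<W>" if "t \<in> {1..Suc n}" "\<omega> \<in> space P" for t \<omega>
  proof (cases "t = 1")
    case True
    then show ?thesis using \<open>W 1 \<in> space P \<rightarrow> \<W>\<close> that by auto
  next
    case False
    with that have "t - 1 \<in> {1..n}" "t - 1 + 1 = t" by auto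
    then show ?thesis
      using algorithm[of "t - 1" \<omega>] that(2) closest_point_in_set[OF domain(1) ne] by simp
  qed

  have dia: "norm (w - u) \<le> \<delta>" if "w \<in> \<W>" "u \<in> \<W>" for w u
    using diameter_bounded_bound[OF domain(3) that] by (simp add: dist_norm \<delta>_def)
  have \<delta>: "0 \<le> \<delta>" using dia ne norm_ge_zero order_trans by blast
  \<comment> \<open>A real supremum is known to be an upper bound only for sets bounded above; the
    uniform \<open>B\<close> supplies this at both levels.\<close>
  have grad_le: "norm (grad g w) \<le> M" if "g \<in> F" "w \<in> \<W>" for g w
  proof -
    obtain B where B: "\<And>g w. g \<in> F \<Longrightarrow> w \<in> \<W> \<Longrightarrow> norm (grad g w) \<le> B"
      using bounded_gradients by blast
    have "norm (grad g w) \<le> (SUP w\<in>\<W>. norm (grad g w))"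
      using B that by (intro cSUP_upper bdd_aboveI2) auto
    also have "\<dots> \<le> M"
      unfolding M(1) using B that ne by (intro cSUP_upper bdd_aboveI2 cSUP_least) auto
    finally show ?thesis .
  qed
  have tangent: "g w - g u \<le> grad g w \<bullet> (w - u)" if "g \<in> F" "w \<in> \<W>" "u \<in> \<W>" for g w u
    using that by (intro convex_on_above_tangent_within[OF convex_losses _ _ gradients])
  have inner_le: "\<bar>grad g w \<bullet> (w - u)\<bar> \<le> M * \<delta>" if "g \<in> F" "w \<in> \<W>" "u \<in> \<W>" for g w u
    using Cauchy_Schwarz_ineq2[of "grad g w" "w - u"] M(2)
      mult_mono[OF grad_le[OF that(1,2)] dia[OF that(2,3)]] by simp
  have risk_diff: "risk \<mu> w - risk \<mu> u = (\<integral>g. g w - g u \<partial>\<mu>)" if "w \<in> \<W>" "u \<in> \<W>" for w u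
    unfolding risk_def using that risk_finite by simp
  \<comment> \<open>Together with its mirror image this makes the risk \<open>M\<close>-Lipschitz on
    \<open>\<W>\<close>. Measurability follows, and by compactness boundedness, hence integrability
    along the iterates.\<close>
  have risk_le: "risk \<mu> w - risk \<mu> u \<le> M * norm (w - u)" if "w \<in> \<W>" "u \<in> \<W>" for w u
  proof -
    have "g w - g u \<le> M * norm (w - u)" if "g \<in> F" for g
    proof -
      have "grad g w \<bullet> (w - u) \<le> norm (grad g w) * norm (w - u)"
        by (rule norm_cauchy_schwarz)
      also have "\<dots> \<le> M * norm (w - u)"
        using grad_le[OF that \<open>w \<in> \<W>\<close>] by (rule mult_right_mono) simp
      finally show ?thesis using tangent[OF that \<open>w \<in> \<W>\<close> \<open>u \<in> \<W>\<close>] by simp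
    qed
    then have "(\<integral>g. g w - g u \<partial>\<mu>) \<le> (\<integral>g. M * norm (w - u) \<partial>\<mu>)"
      using that risk_finite law(2) by (intro integral_mono) auto
    then show ?thesis using that by (simp add: risk_diff \<mu>.prob_space)
  qed
  have risk_cont: "continuous_on \<W> (risk \<mu>)"
  proof -
    have "dist (risk \<mu> w) (risk \<mu> u) \<le> M * dist w u" if "w \<in> \<W>" "u \<in> \<W>" for w u
      using risk_le[OF that] risk_le[OF that(2,1)]
      by (simp add: dist_norm norm_minus_commute abs_le_iff)
    then show ?thesis
      using M(2) by (intro lipschitz_on_continuous_on[of M] lipschitz_onI) auto
  qed
  have risk_meas: "risk \<mu> \<in> borel_measurable RW"
    unfolding RW_def by (rule borel_measurable_continuous_on_restrict[OF risk_cont])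
  obtain C where C: "\<And>w. w \<in> \<W> \<Longrightarrow> norm (risk \<mu> w) \<le> C"
    using compact_imp_bounded[OF compact_continuous_image[OF risk_cont]] domain
    by (auto simp: compact_eq_bounded_closed bounded_iff)

  \<comment> \<open>Measurability of the iterates\<close>
  have RW_borel[measurable]: "(\<lambda>w. w) \<in> borel_measurable RW"
    unfolding RW_def by (simp add: measurable_restrict_space1)
  have into_RW: "X \<in> measurable N RW" if "X \<in> borel_measurable N" "X \<in> space N \<rightarrow> \<W>" for X N
    unfolding RW_def using that by (intro measurable_restrict_space2) auto
  note grad_meas[measurable] = gradient_measurable[folded RW_def]
  have f_G: "f t \<in> measurable (G K) \<mu>" if "t \<in> {1..n}" "Sample t \<in> K" for t K
    using that f_in law(2) by (intro G_measurable[of "Sample t"]) (auto simp: E_def)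
  have Z_G: "Z t \<in> borel_measurable (G K)" if "t \<in> {1..n}" "Noise t \<in> K" for t K
    using that by (intro G_measurable[of "Noise t"]) (auto simp: E_def)
  have G_mono: "X \<in> measurable (G L) N" if "X \<in> measurable (G K) N" "K \<subseteq> L" for X K L and N :: "'x measure"
  proof -
    have "sets (G K) \<subseteq> sets (G L)"
      using that(2) E_Pow by (auto simp: G_def intro!: sigma_sets_mono')
    then show ?thesis using that(1) by (auto simp: measurable_def)
  qed
  \<comment> \<open>Adaptedness, by induction: the recursion gives the next iterate as a measurable
    function of \<open>W t\<close>, \<open>f t\<close> and \<open>Z t\<close>, all of which are
    determined by \<open>past (Suc t)\<close>.\<close>
  have W_G: "W t \<in> measurable (G (past t)) RW" if "t \<in> {1..Suc n}" for t
  proof -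
    have "1 \<le> t" "t \<le> Suc n" using that by auto
    then show ?thesis
    proof (induction t rule: dec_induct)
      case base
      have "W 1 \<in> borel_measurable (G (past 1))"
        by (rule G_measurable[of Initial]) (auto simp: E_def past_def)
      then show ?case using W_in by (intro into_RW) auto
    next
      case (step t)
      then have t: "t \<in> {1..n}" by auto
      let ?K = "past (Suc t)"
      have [measurable]: "W t \<in> measurable (G ?K) RW"
        by (rule G_mono[of _ "past t"]) (use step in \<open>auto simp: past_def\<close>)
      have [measurable]: "f t \<in> measurable (G ?K) \<mu>" "Z t \<in> borel_measurable (G ?K)"
        using t by (auto simp: past_def intro!: f_G Z_G)
      have [measurable]: "W t \<in> borel_measurable (G ?K)"
        using measurable_compose[OF \<open>W t \<in> measurable (G ?K) RW\<close> RW_borel] .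
      have [measurable]: "(\<lambda>\<omega>. grad (f t \<omega>) (W t \<omega>)) \<in> borel_measurable (G ?K)"
        using measurable_compose[OF _ grad_meas, of "\<lambda>\<omega>. (f t \<omega>, W t \<omega>)" "G ?K"] by simp
      have [measurable]: "closest_point \<W> \<in> borel_measurable borel"
        by (intro borel_measurable_continuous_onI continuous_on_closest_point domain ne)
      have "(\<lambda>\<omega>. closest_point \<W> (W t \<omega> - \<eta> t *\<^sub>R grad (f t \<omega>) (W t \<omega>) + (\<eta> t * \<sigma> t) *\<^sub>R Z t \<omega>))
          \<in> borel_measurable (G ?K)"
        by measurable
      then have "W (Suc t) \<in> borel_measurable (G ?K)"
        by (rule measurable_cong[THEN iffD1, rotated]) (use algorithm[OF t] in auto)
      then show ?case using W_in step by (intro into_RW) auto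
    qed
  qed
  \<comment> \<open>Independence from the trivial sigma-algebra \<open>G {}\<close> is invoked only
    to know that the sets of \<open>G (past t)\<close> are events of \<open>P\<close>.\<close>
  have W_P: "W t \<in> measurable P RW" if "t \<in> {1..Suc n}" for t
    using P.measurable_sub_sigma_algebra(1)[OF _ _ indep_G[OF past_sub'[OF that], of "{}"] W_G[OF that]]
    by simp
  have risk_W: "integrable P (\<lambda>\<omega>. risk \<mu> (W t \<omega>))" if "t \<in> {1..n}" for t
    using that C W_in measurable_compose[OF W_P risk_meas]
    by (intro P.integrable_const_bound[of _ C]) auto

  \<comment> \<open>Averaging over the random time\<close>
  have random_time: "(\<integral>\<omega>. risk \<mu> (W (T \<omega>) \<omega>) \<partial>P) = (\<Sum>t=1..n. \<integral>\<omega>. risk \<mu> (W t \<omega>) \<partial>P) / n"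
  proof -
    have T_in: "T \<omega> \<in> {1..n}" if "\<omega> \<in> space P" for \<omega>
      using measurable_space[OF stopping(1) that] by simp
    have hit: "integrable P (\<lambda>\<omega>. indicat_real {t} (T \<omega>))"
      "(\<integral>\<omega>. indicat_real {t} (T \<omega>) \<partial>P) = 1 / n" if "t \<in> {1..n}" for t
    proof -
      have [measurable]: "T \<in> measurable P (count_space {1..n})" by (rule stopping(1))
      show "integrable P (\<lambda>\<omega>. indicat_real {t} (T \<omega>))"
        by (intro P.integrable_const_bound[of _ 1]) (auto simp: indicator_def)
      have "(\<integral>\<omega>. indicat_real {t} (T \<omega>) \<partial>P) = (\<integral>s. indicat_real {t} s \<partial>distr P (count_space {1..n}) T)"
        by (rule integral_distr[OF stopping(1), symmetric]) simp
      also have "\<dots> = measure (uniform_count_measure {1..n}) {t}"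
        unfolding stopping(2) using that by (simp add: space_uniform_count_measure)
      also have "\<dots> = 1 / n"
        using that by (simp add: measure_uniform_count_measure)
      finally show "(\<integral>\<omega>. indicat_real {t} (T \<omega>) \<partial>P) = 1 / n" .
    qed
    \<comment> \<open>Since \<open>Stopping\<close> is not in \<open>past t\<close>, the event that
      \<open>T\<close> equals \<open>t\<close> is independent of \<open>W t\<close> and contributes
      its probability \<open>1 / n\<close> as a factor.\<close>
    have prod: "integrable P (\<lambda>\<omega>. indicat_real {t} (T \<omega>) * risk \<mu> (W t \<omega>))"
      "(\<integral>\<omega>. indicat_real {t} (T \<omega>) * risk \<mu> (W t \<omega>) \<partial>P) = (\<integral>\<omega>. risk \<mu> (W t \<omega>) \<partial>P) / n"
      if t: "t \<in> {1..n}" for t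
    proof -
      have "T \<in> measurable (G {Stopping}) (count_space UNIV)"
        by (rule G_measurable[of Stopping]) (auto simp: E_def)
      then have "(\<lambda>\<omega>. indicat_real {t} (T \<omega>)) \<in> borel_measurable (G {Stopping})"
        by (rule measurable_compose) simp
      moreover have "(\<lambda>\<omega>. risk \<mu> (W t \<omega>)) \<in> borel_measurable (G (past t))"
        using measurable_compose[OF W_G risk_meas] t by simp
      moreover have "P.indep_set (sets (G {Stopping})) (sets (G (past t)))"
        by (rule indep_G) (use past_sub'[of t] t in \<open>auto simp: I_def past_def\<close>)
      ultimately have "P.indep_var borel (\<lambda>\<omega>. indicat_real {t} (T \<omega>)) borel (\<lambda>\<omega>. risk \<mu> (W t \<omega>))"
        by (intro P.indep_var_of_indep_sigma_algebras) simp_all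
      from P.indep_var_integrable[OF this hit(1)[OF t] risk_W[OF t]]
        P.indep_var_lebesgue_integral[OF this hit(1)[OF t] risk_W[OF t]]
      show "integrable P (\<lambda>\<omega>. indicat_real {t} (T \<omega>) * risk \<mu> (W t \<omega>))"
        "(\<integral>\<omega>. indicat_real {t} (T \<omega>) * risk \<mu> (W t \<omega>) \<partial>P) = (\<integral>\<omega>. risk \<mu> (W t \<omega>) \<partial>P) / n"
        using hit(2)[OF t] by simp_all
    qed
    have "(\<integral>\<omega>. risk \<mu> (W (T \<omega>) \<omega>) \<partial>P)
        = (\<integral>\<omega>. (\<Sum>t=1..n. indicat_real {t} (T \<omega>) * risk \<mu> (W t \<omega>)) \<partial>P)"
    proof (rule Bochner_Integration.integral_cong[OF refl])
      fix \<omega> assume "\<omega> \<in> space P"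
      then show "risk \<mu> (W (T \<omega>) \<omega>) = (\<Sum>t=1..n. indicat_real {t} (T \<omega>) * risk \<mu> (W t \<omega>))"
        using T_in by (subst sum.remove[of _ "T \<omega>"]) (auto simp: indicator_def)
    qed
    also have "\<dots> = (\<Sum>t=1..n. \<integral>\<omega>. indicat_real {t} (T \<omega>) * risk \<mu> (W t \<omega>) \<partial>P)"
      using prod(1) by (rule Bochner_Integration.integral_sum)
    finally show ?thesis
      using prod(2) by (simp add: sum_divide_distrib)
  qed

  \<comment> \<open>Total excess risk against a fixed comparator\<close>
  have regret: "(\<Sum>t=1..n. (\<integral>\<omega>. risk \<mu> (W t \<omega>) \<partial>P) - risk \<mu> u)
      \<le> 3 / 2 * M * \<delta> * sqrt n + CARD('d) / 2 * (\<Sum>t=1..n. \<eta> t * (\<sigma> t)\<^sup>2)"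
    if u: "u \<in> \<W>" for u
  proof (cases "\<delta> = 0")
    \<comment> \<open>Here every step size is \<open>0\<close>, so dividing by \<open>\<eta> t\<close> is not possible.\<close>
    case True
    have "risk \<mu> (W t \<omega>) = risk \<mu> u" if "t \<in> {1..n}" "\<omega> \<in> space P" for t \<omega>
      using dia[OF W_in u, of t \<omega>] True that by simp
    then have "(\<integral>\<omega>. risk \<mu> (W t \<omega>) \<partial>P) = risk \<mu> u" if "t \<in> {1..n}" for t
      using that by (simp add: P.prob_space cong: Bochner_Integration.integral_cong)
    then show ?thesis
      using True \<eta> by (simp add: \<delta>_def)
  next
    case False
    with \<delta> have \<delta>_pos: "0 < \<delta>" by simp
    have \<eta>_eq: "\<eta> t = \<delta> / (M * sqrt t)" if "t \<in> {1..n}" for t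
      using \<eta>[OF that] by (simp add: \<delta>_def)
    have \<eta>_pos: "0 < \<eta> t" if "t \<in> {1..n}" for t
      using that \<delta>_pos M(2) by (simp add: \<eta>_eq)
    \<comment> \<open>In the rounds \<open>1..n\<close> this is \<open>1 / (2 * \<eta> t)\<close>,
      the weight that division by the step size puts on the distances; it is nondecreasing, as
      summation by parts requires.\<close>
    define a where "a t = M * sqrt t / (2 * \<delta>)" for t :: nat
    define D where "D t = (\<integral>\<omega>. (norm (W t \<omega> - u))\<^sup>2 \<partial>P)" for t
    have D_le: "integrable P (\<lambda>\<omega>. (norm (W t \<omega> - u))\<^sup>2)" "D t \<le> \<delta>\<^sup>2" "0 \<le> D t"
      if t: "t \<in> {1..Suc n}" for t
    proof -
      have [measurable]: "W t \<in> borel_measurable P"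
        using measurable_compose[OF W_P[OF t] RW_borel] .
      have b: "(norm (W t \<omega> - u))\<^sup>2 \<le> \<delta>\<^sup>2" if "\<omega> \<in> space P" for \<omega>
        using dia[OF W_in[OF t that] u] by (intro power_mono) auto
      show int: "integrable P (\<lambda>\<omega>. (norm (W t \<omega> - u))\<^sup>2)"
        using b by (intro P.integrable_const_bound[of _ "\<delta>\<^sup>2"]) auto
      have "D t \<le> (\<integral>\<omega>. \<delta>\<^sup>2 \<partial>P)"
        unfolding D_def using int b by (intro integral_mono) auto
      then show "D t \<le> \<delta>\<^sup>2" by (simp add: P.prob_space)
      show "0 \<le> D t" by (simp add: D_def)
    qed
    have step: "(\<integral>\<omega>. risk \<mu> (W t \<omega>) \<partial>P) - risk \<mu> u
        \<le> a t * (D t - D (Suc t)) + M * \<delta> / 2 * (1 / sqrt t) + CARD('d) / 2 * (\<eta> t * (\<sigma> t)\<^sup>2)"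
      if t: "t \<in> {1..n}" for t
    proof -
      \<comment> \<open>The variable \<open>Y\<close> below depends on the current loss as well as
        on \<open>W t\<close>, so \<open>Sample t\<close> joins the past; \<open>Noise t\<close> is
        still outside.\<close>
      let ?K = "insert (Sample t) (past t)"
      define h where "h = (\<lambda>(g, w). grad g w \<bullet> (w - u))"
      define Y where "Y \<omega> = W t \<omega> - u - \<eta> t *\<^sub>R grad (f t \<omega>) (W t \<omega>)" for \<omega>
      have t': "t \<in> {1..Suc n}" using t by auto
      have [measurable]: "W t \<in> measurable P RW" "f t \<in> measurable P \<mu>"
        using W_P[OF t'] samples(1)[OF t] .
      have [measurable]: "h \<in> borel_measurable (\<mu> \<Otimes>\<^sub>M RW)"
      proof -
        have [measurable]: "snd \<in> borel_measurable (\<mu> \<Otimes>\<^sub>M RW)"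
          using measurable_compose[OF measurable_snd RW_borel] .
        have "(\<lambda>x. (case x of (g, w) \<Rightarrow> grad g w) \<bullet> (snd x - u)) \<in> borel_measurable (\<mu> \<Otimes>\<^sub>M RW)"
          by measurable
        then show ?thesis by (simp add: h_def case_prod_beta')
      qed
      have h_le: "\<bar>h (f t \<omega>, W t \<omega>)\<bar> \<le> M * \<delta>" if "\<omega> \<in> space P" for \<omega>
        using inner_le[OF f_in[OF t that] W_in[OF t' that] u] by (simp add: h_def)
      have h_int: "integrable P (\<lambda>\<omega>. h (f t \<omega>, W t \<omega>))"
        using h_le by (intro P.integrable_const_bound[of _ "M * \<delta>"]) auto
      \<comment> \<open>The loss \<open>f t\<close> is integrated with \<open>W t\<close> frozen at
        \<open>w\<close>, where the tangent inequality for every \<open>g\<close> gives the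
        bound.\<close>
      have "(\<integral>\<omega>. risk \<mu> (W t \<omega>) - risk \<mu> u \<partial>P) \<le> (\<integral>\<omega>. h (f t \<omega>, W t \<omega>) \<partial>P)"
      proof (rule P.expectation_le_of_conditional_bound)
        show "distr P (\<mu> \<Otimes>\<^sub>M RW) (\<lambda>\<omega>. (f t \<omega>, W t \<omega>)) = distr P \<mu> (f t) \<Otimes>\<^sub>M distr P RW (W t)"
        proof (rule P.distr_Pair_of_indep_sigma_algebras)
          show "P.indep_set (sets (G {Sample t})) (sets (G (past t)))"
            by (rule indep_G) (use past_sub[OF t] in \<open>auto simp: past_def\<close>)
        qed (use f_G[OF t] W_G[OF t'] in auto)
        show "risk \<mu> w - risk \<mu> u \<le> (\<integral>g. h (g, w) \<partial>distr P \<mu> (f t))" if "w \<in> space RW" for w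
        proof -
          have w: "w \<in> \<W>" using that by simp
          have "(\<lambda>g. h (g, w)) \<in> borel_measurable \<mu>" using that by measurable
          then have "integrable \<mu> (\<lambda>g. h (g, w))"
            using inner_le[OF _ w u] law(2)
            by (intro \<mu>.integrable_const_bound[of _ "M * \<delta>"]) (auto simp: h_def)
          then have "(\<integral>g. g w - g u \<partial>\<mu>) \<le> (\<integral>g. h (g, w) \<partial>\<mu>)"
            using risk_finite w u tangent law(2) by (intro integral_mono) (auto simp: h_def)
          then show ?thesis
            by (simp add: risk_diff[OF w u] samples(2)[OF t])
        qed
      qed (use risk_meas risk_W[OF t] h_int in auto)
      then have risk_h: "(\<integral>\<omega>. risk \<mu> (W t \<omega>) \<partial>P) - risk \<mu> u \<le> (\<integral>\<omega>. h (f t \<omega>, W t \<omega>) \<partial>P)"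
        using risk_W[OF t] by (simp add: P.prob_space)

      \<comment> \<open>\<open>Y\<close> is bounded, hence integrable, and independent of the
        centred noise \<open>Z t\<close>.\<close>
      have cross: "integrable P (\<lambda>\<omega>. Z t \<omega> \<bullet> Y \<omega>)" "(\<integral>\<omega>. Z t \<omega> \<bullet> Y \<omega> \<partial>P) = 0"
      proof -
        have [measurable]: "f t \<in> measurable (G ?K) \<mu>" "W t \<in> measurable (G ?K) RW"
          using f_G[OF t] G_mono[OF W_G[OF t'] subset_insertI] by auto
        have [measurable]: "W t \<in> borel_measurable (G ?K)"
          using measurable_compose[OF \<open>W t \<in> measurable (G ?K) RW\<close> RW_borel] .
        have [measurable]: "(\<lambda>\<omega>. grad (f t \<omega>) (W t \<omega>)) \<in> borel_measurable (G ?K)"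
          using measurable_compose[OF _ grad_meas, of "\<lambda>\<omega>. (f t \<omega>, W t \<omega>)" "G ?K"] by simp
        have Y_G: "Y \<in> borel_measurable (G ?K)"
          unfolding Y_def by measurable
        have ind: "P.indep_set (sets (G {Noise t})) (sets (G ?K))"
          by (rule indep_G) (use past_sub[OF t] t in \<open>auto simp: past_def I_def\<close>)
        have "norm (Y \<omega>) \<le> \<delta> + \<eta> t * M" if "\<omega> \<in> space P" for \<omega>
        proof -
          have "norm (Y \<omega>) \<le> norm (W t \<omega> - u) + norm (\<eta> t *\<^sub>R grad (f t \<omega>) (W t \<omega>))"
            unfolding Y_def by (rule norm_triangle_ineq4)
          also have "\<dots> \<le> \<delta> + \<eta> t * M"
            using dia[OF W_in[OF t' that] u] grad_le[OF f_in[OF t that] W_in[OF t' that]] \<eta>_pos[OF t]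
            by (intro add_mono) (auto simp: mult_left_mono)
          finally show ?thesis .
        qed
        moreover have "Y \<in> borel_measurable P"
          by (rule P.measurable_sub_sigma_algebra(2)[OF _ _ ind Y_G]) simp_all
        ultimately have "integrable P Y"
          by (intro P.integrable_const_bound[of _ "\<delta> + \<eta> t * M"]) auto
        moreover have "P.indep_var borel (\<lambda>\<omega>. Z t \<omega> \<bullet> b) borel (\<lambda>\<omega>. Y \<omega> \<bullet> b)" for b
          using Z_G[OF t, of "{Noise t}"] Y_G
          by (intro P.indep_var_of_indep_sigma_algebras[OF _ _ ind]) auto
        ultimately show "integrable P (\<lambda>\<omega>. Z t \<omega> \<bullet> Y \<omega>)" "(\<integral>\<omega>. Z t \<omega> \<bullet> Y \<omega> \<partial>P) = 0"
          using inner_indep_zero_mean[OF prob, of "Z t" Y]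
            gaussian_component_moments[OF noise(1)[OF t] noise(2)[OF t]] by auto
      qed

      note Z_sq = gaussian_norm_square[OF noise(1)[OF t] noise(2)[OF t]]
      have t'': "Suc t \<in> {1..Suc n}" using t by auto
      have "(\<integral>\<omega>. 2 * \<eta> t * h (f t \<omega>, W t \<omega>) \<partial>P)
          \<le> (\<integral>\<omega>. (norm (W t \<omega> - u))\<^sup>2 - (norm (W (Suc t) \<omega> - u))\<^sup>2 + (\<eta> t)\<^sup>2 * M\<^sup>2
              + (\<eta> t)\<^sup>2 * (\<sigma> t)\<^sup>2 * (norm (Z t \<omega>))\<^sup>2 + 2 * \<eta> t * \<sigma> t * (Z t \<omega> \<bullet> Y \<omega>) \<partial>P)"
      proof (rule integral_mono)
        fix \<omega> assume \<omega>: "\<omega> \<in> space P"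
        show "2 * \<eta> t * h (f t \<omega>, W t \<omega>) \<le> (norm (W t \<omega> - u))\<^sup>2 - (norm (W (Suc t) \<omega> - u))\<^sup>2
            + (\<eta> t)\<^sup>2 * M\<^sup>2 + (\<eta> t)\<^sup>2 * (\<sigma> t)\<^sup>2 * (norm (Z t \<omega>))\<^sup>2 + 2 * \<eta> t * \<sigma> t * (Z t \<omega> \<bullet> Y \<omega>)"
          using projected_noisy_step[OF domain(1,2) u grad_le[OF f_in[OF t \<omega>] W_in[OF t' \<omega>]],
              of "\<eta> t" "W t \<omega>" "\<sigma> t" "Z t \<omega>"] algorithm[OF t \<omega>]
          by (simp add: h_def Y_def)
      qed (use h_int D_le(1)[OF t'] D_le(1)[OF t''] Z_sq cross in auto)
      also have "\<dots> = D t - D (Suc t) + (\<eta> t)\<^sup>2 * M\<^sup>2 + (\<eta> t)\<^sup>2 * (\<sigma> t)\<^sup>2 * CARD('d)"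
        using D_le(1)[OF t'] D_le(1)[OF t''] Z_sq cross by (simp add: D_def P.prob_space)
      finally have "2 * \<eta> t * (\<integral>\<omega>. h (f t \<omega>, W t \<omega>) \<partial>P)
          \<le> D t - D (Suc t) + (\<eta> t)\<^sup>2 * M\<^sup>2 + (\<eta> t)\<^sup>2 * (\<sigma> t)\<^sup>2 * CARD('d)"
        by simp
      then have "(\<integral>\<omega>. h (f t \<omega>, W t \<omega>) \<partial>P)
          \<le> (D t - D (Suc t)) / (2 * \<eta> t) + \<eta> t * M\<^sup>2 / 2 + CARD('d) / 2 * (\<eta> t * (\<sigma> t)\<^sup>2)"
        using \<eta>_pos[OF t] by (simp add: field_simps power2_eq_square)
      moreover have "(D t - D (Suc t)) / (2 * \<eta> t) = a t * (D t - D (Suc t))"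
        using t \<delta>_pos M(2) by (simp add: \<eta>_eq a_def)
      moreover have "\<eta> t * M\<^sup>2 / 2 = M * \<delta> / 2 * (1 / sqrt t)"
        using t M(2) by (simp add: \<eta>_eq power2_eq_square field_simps)
      ultimately show ?thesis using risk_h by linarith
    qed
    have "(\<Sum>t=1..n. a t * (D t - D (Suc t))) \<le> a n * (\<delta>\<^sup>2 - D (Suc n))"
      using n M(2) \<delta>_pos D_le(2)
      by (intro sum_weighted_differences_le) (auto simp: a_def divide_right_mono mult_left_mono)
    also have "\<dots> \<le> a n * \<delta>\<^sup>2"
      using D_le(3)[of "Suc n"] M(2) \<delta>_pos by (intro mult_left_mono) (auto simp: a_def)
    also have "\<dots> = M * \<delta> / 2 * sqrt n"
      using \<delta>_pos by (simp add: a_def power2_eq_square)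
    finally have drift: "(\<Sum>t=1..n. a t * (D t - D (Suc t))) \<le> M * \<delta> / 2 * sqrt n" .
    \<comment> \<open>Origin of the constant 3/2: the gradient terms contribute 1 and the drift
      contributes 1/2, each times \<open>M * \<delta> * sqrt n\<close>.\<close>
    have "M * \<delta> / 2 * (\<Sum>t=1..n. 1 / sqrt t) \<le> M * \<delta> / 2 * (2 * sqrt n)"
      using M(2) \<delta>_pos by (intro mult_left_mono sum_inverse_sqrt_le) auto
    moreover have "(\<Sum>t=1..n. (\<integral>\<omega>. risk \<mu> (W t \<omega>) \<partial>P) - risk \<mu> u)
        \<le> (\<Sum>t=1..n. a t * (D t - D (Suc t)) + M * \<delta> / 2 * (1 / sqrt t)
            + CARD('d) / 2 * (\<eta> t * (\<sigma> t)\<^sup>2))"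
      using step by (rule sum_mono)
    ultimately show ?thesis
      using drift unfolding sum.distrib sum_distrib_left[symmetric] by (simp add: algebra_simps)
  qed

  \<comment> \<open>Passage to the infimum\<close>
  let ?bound = "3 * M * diameter \<W> / (2 * sqrt (real n))
      + real CARD('d) / (2 * real n) * (\<Sum>t=1..n. \<eta> t * (\<sigma> t)\<^sup>2)"
  \<comment> \<open>With \<open>?bound\<close> moved to the left, the claim is that a number
    independent of \<open>u\<close> is a lower bound of all \<open>risk \<mu> u\<close>.\<close>
  have "(\<integral>\<omega>. risk \<mu> (W (T \<omega>) \<omega>) \<partial>P) - ?bound \<le> (INF w\<in>\<W>. risk \<mu> w)"
  proof (rule cINF_greatest[OF ne])
    fix u assume "u \<in> \<W>"
    have "(\<Sum>t=1..n. \<integral>\<omega>. risk \<mu> (W t \<omega>) \<partial>P) / n - risk \<mu> u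
        = (\<Sum>t=1..n. (\<integral>\<omega>. risk \<mu> (W t \<omega>) \<partial>P) - risk \<mu> u) / n"
      using n by (simp add: sum_subtractf diff_divide_distrib)
    also have "\<dots> \<le> (3 / 2 * M * \<delta> * sqrt n + CARD('d) / 2 * (\<Sum>t=1..n. \<eta> t * (\<sigma> t)\<^sup>2)) / n"
      using regret[OF \<open>u \<in> \<W>\<close>] by (rule divide_right_mono) simp
    also have "\<dots> = 3 / 2 * M * \<delta> * (sqrt n / n) + CARD('d) / (2 * n) * (\<Sum>t=1..n. \<eta> t * (\<sigma> t)\<^sup>2)"
      by (simp add: add_divide_distrib)
    also have "sqrt n / n = 1 / sqrt n"
      using n by (simp add: field_simps)
    also have "3 / 2 * M * \<delta> * (1 / sqrt n) + CARD('d) / (2 * n) * (\<Sum>t=1..n. \<eta> t * (\<sigma> t)\<^sup>2) = ?bound"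
      by (simp add: \<delta>_def)
    finally show "(\<integral>\<omega>. risk \<mu> (W (T \<omega>) \<omega>) \<partial>P) - ?bound \<le> risk \<mu> u"
      by (simp add: random_time)
  qed
  then show ?thesis by (simp add: stochastic_regret_def)
qed

end
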